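(* Let $q\ge 3$ be an integer and let $a$ be an integer coprime to $q$. Let $c_\pi(q)$ and $x_\pi(q)$ be the positive constants described in the context. Suppose that $c_\pi(q)\varphi(q)<1$. Then for all $x>x_\pi(q)$, $$\frac{x}{\varphi(q)\log x}<\pi(x;q,a)<\frac{x}{\varphi(q)\log x}\left(1+\frac{5}{2\log x}\right).$$
   Context: $\varphi$ is Euler's totient function, $\log$ is the natural logarithm, $\pi(x;q,a)$ is the number of primes $p\le x$ with $p\equiv a\pmod q$, and $\operatorname{Li}(x)=\int_2^x\frac{dt}{\log t}$. Constants $c_\pi(q),x_\pi(q)$: for each integer $q\ge3$ these are fixed explicit positive constants with the property that, for every integer $b$ coprime to $q$, $$\left|\pi(x;q,b)-\frac{\operatorname{Li}(x)}{\varphi(q)}\right|<c_\pi(q)\,\frac{x}{(\log x)^2}\qquad\text{for all }x\ge x_\pi(q).$$ For $q>10^5$ they are $c_\pi(q)=\frac1{160}$ and $x_\pi(q)=\exp(0.03\sqrt q(\log q)^3)$; for $3\le q\le10^5$ they are tabulated numerical constants with $c_\pi(q)\le\frac1{840}$ if $q\le 10^4$, $c_\pi(q)\le\frac1{160}$ if $q>10^4$, and $x_\pi(q)\le 8\cdot10^9$ being the smallest positive real number for which the displayed inequality holds for all $x\ge x_\pi(q)$ and all $b$ coprime to $q$. These constants satisfy $x_\pi(q)\ge 14735$ for all $q\ge3$. *)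

theory Defs
  imports "HOL-Analysis.Analysis" "HOL-Number_Theory.Number_Theory"
begin

definition primes_ap_count :: "real \<Rightarrow> nat \<Rightarrow> int \<Rightarrow> nat" where
  "primes_ap_count x q a = card {p :: nat. prime p \<and> real p \<le> x \<and> [int p = a] (mod int q)}"

text \<open>The integral is over the set of reals between 2 and \<open>x\<close>, so \<open>Li\<close> is the logarithmic
  integral for \<open>x \<ge> 2\<close> and \<open>0\<close> below that.\<close>
definition Li :: "real \<Rightarrow> real" where
  "Li x = integral {2..x} (\<lambda>t. 1 / ln t)"

definition pi_bound_from :: "nat \<Rightarrow> real \<Rightarrow> real \<Rightarrow> bool" where
  "pi_bound_from q c X \<longleftrightarrow>
     (\<forall>b :: int. coprime b (int q) \<longrightarrow>
       (\<forall>x \<ge> X. \<bar>real (primes_ap_count x q b) - Li x / real (totient q)\<bar> < c * (x / (ln x)\<^sup>2)))"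

text \<open>\<open>pi_constants q c X\<close> says that \<open>c\<close> and \<open>X\<close> have all the properties of the constants
  \<open>c\<^sub>\<pi>(q)\<close> and \<open>x\<^sub>\<pi>(q)\<close>. For \<open>q \<le> 10 ^ 5\<close> the value \<open>c\<^sub>\<pi>(q)\<close> comes from a numerical table and enters
  only through its upper bound; \<open>x\<^sub>\<pi>(q)\<close> is then the smallest positive threshold belonging to it.
  That these constants exist is a separate theorem, so their properties appear as a hypothesis.\<close>
definition pi_constants :: "nat \<Rightarrow> real \<Rightarrow> real \<Rightarrow> bool" where
  "pi_constants q c X \<longleftrightarrow>
     0 < c \<and> 0 < X \<and> 14735 \<le> X \<and> pi_bound_from q c X \<and>
     (q > 10 ^ 5 \<longrightarrow>
        c = 1 / 160 \<and> X = exp (3 / 100 * sqrt (real q) * (ln (real q)) ^ 3)) \<and>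
     (q \<le> 10 ^ 5 \<longrightarrow>
        (q \<le> 10 ^ 4 \<longrightarrow> c \<le> 1 / 840) \<and> (q > 10 ^ 4 \<longrightarrow> c \<le> 1 / 160) \<and> X \<le> 8 * 10 ^ 9 \<and>
        (\<forall>Y > 0. pi_bound_from q c Y \<longrightarrow> X \<le> Y))"

end

(* Since c \<phi>(q) < 1, it suffices that x/L + x/L^2 \<le> Li(x) \<le> x/L + (3/2) x/L^2 with L = ln x for
   x \<ge> e^9, which covers x \<ge> 14735. Beyond e^9 both bounds follow by comparing derivatives. At e^9
   the lower bound has ample room, and the upper one comes from bounding 1/u by its secant on
   each interval [k, k + 1], after the substitution t = e^u. *)
theory Submission
  imports Defs
begin

lemma inverse_ln_integrable:
  fixes a b :: real
  assumes "2 \<le> a"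
  shows "(\<lambda>t. 1 / ln t) integrable_on {a..b}"
  using assms by (intro integrable_continuous_interval continuous_intros) auto

lemma Li_diff:
  assumes "2 \<le> a" "a \<le> b"
  shows "Li b - Li a = integral {a..b} (\<lambda>t. 1 / ln t)"
  using Henstock_Kurzweil_Integration.integral_combine[OF assms inverse_ln_integrable[of 2 b]]
  by (simp add: Li_def)

text \<open>Together with its mirror image \<open>Li_diff_ge\<close>, this carries every later
  estimate of \<open>Li\<close>; what remains each time is to choose an explicit \<open>G\<close>
  whose derivative lies on the right side of the integrand.\<close>

lemma Li_diff_le:
  assumes "2 \<le> a" "a \<le> b"
    and deriv: "\<And>t. a \<le> t \<Longrightarrow> t \<le> b \<Longrightarrow> (G has_real_derivative g t) (at t)"
    and le: "\<And>t. a \<le> t \<Longrightarrow> t \<le> b \<Longrightarrow> 1 / ln t \<le> g t"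
  shows "Li b - Li a \<le> G b - G a"
proof -
  have "(g has_integral (G b - G a)) {a..b}"
    using assms(2) deriv
    by (intro fundamental_theorem_of_calculus)
      (auto simp flip: has_real_derivative_iff_has_vector_derivative intro: has_field_derivative_at_within)
  then show ?thesis
    using has_integral_le[OF integrable_integral[OF inverse_ln_integrable[OF assms(1)]]] le
    by (simp add: Li_diff[OF assms(1,2)])
qed

lemma Li_diff_ge:
  assumes "2 \<le> a" "a \<le> b"
    and deriv: "\<And>t. a \<le> t \<Longrightarrow> t \<le> b \<Longrightarrow> (G has_real_derivative g t) (at t)"
    and le: "\<And>t. a \<le> t \<Longrightarrow> t \<le> b \<Longrightarrow> g t \<le> 1 / ln t"
  shows "G b - G a \<le> Li b - Li a"
proof -
  have "(g has_integral (G b - G a)) {a..b}"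
    using assms(2) deriv
    by (intro fundamental_theorem_of_calculus)
      (auto simp flip: has_real_derivative_iff_has_vector_derivative intro: has_field_derivative_at_within)
  then show ?thesis
    using has_integral_le[OF _ integrable_integral[OF inverse_ln_integrable[OF assms(1)]]] le
    by (simp add: Li_diff[OF assms(1,2)])
qed

text \<open>Splitting off \<open>1 / ln t\<close> leaves an error whose sign can be read off: for
  \<open>c = 1\<close> it is \<open>- 2 / (ln t) ^ 3\<close>, always negative, and for
  \<open>c = 3 / 2\<close> it is nonnegative as soon as \<open>ln t\<close> is at least 6.\<close>

lemma has_real_derivative_Li_approx:
  fixes c t :: real
  assumes "t > 1"
  shows "((\<lambda>t. t / ln t + c * (t / (ln t)\<^sup>2)) has_real_derivative
    1 / ln t + ((c - 1) * ln t - 2 * c) / (ln t) ^ 3) (at t)"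
proof -
  have "ln t > 0" "t > 0"
    using assms by auto
  then show ?thesis
    by (auto intro!: derivative_eq_intros)
      (simp add: field_simps eval_nat_numeral)
qed

text \<open>By convexity, \<open>1 / ln t\<close> lies below its secant in the variable
  \<open>ln t\<close> between \<open>u\<close> and \<open>v\<close>, which is
  \<open>(u + v - ln t) / (u * v)\<close>. Unlike \<open>1 / ln t\<close>, the secant has an
  elementary antiderivative, \<open>t * (u + v + 1 - ln t) / (u * v)\<close>.\<close>

lemma Li_diff_exp_le:
  fixes u v :: real
  assumes "2 \<le> exp u" "u \<le> v"
  shows "Li (exp v) - Li (exp u) \<le> (exp v * (u + 1) - exp u * (v + 1)) / (u * v)"
proof -
  have u: "u > 0"
    using assms(1) by (smt (verit) exp_le_one_iff)
  have "Li (exp v) - Li (exp u) \<le>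
    exp v * (u + v + 1 - ln (exp v)) / (u * v) - exp u * (u + v + 1 - ln (exp u)) / (u * v)"
  proof (rule Li_diff_le[OF assms(1)])
    fix t assume t: "exp u \<le> t" "t \<le> exp v"
    then have t0: "t > 0"
      by (smt (verit) exp_gt_zero)
    then show "((\<lambda>t. t * (u + v + 1 - ln t) / (u * v)) has_real_derivative
      (u + v - ln t) / (u * v)) (at t)"
      using u assms(2) by (auto intro!: derivative_eq_intros simp: field_simps)
    have L: "u \<le> ln t" "ln t \<le> v"
      using t t0 ln_le_cancel_iff[of t "exp v"] by (simp_all add: ln_ge_iff)
    \<comment> \<open>Divided by \<open>u * v * ln t\<close>, this product is exactly the secant
      minus \<open>1 / ln t\<close>.\<close>
    then have "(ln t - u) * (v - ln t) \<ge> 0"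
      by simp
    then show "1 / ln t \<le> (u + v - ln t) / (u * v)"
      using u L assms(2) by (simp add: field_simps)
  qed (use assms in auto)
  then show ?thesis
    by (simp add: algebra_simps diff_divide_distrib)
qed

lemma exp_1_bounds: "27 / 10 \<le> exp (1 :: real)" "exp (1 :: real) \<le> 272 / 100"
  using e_approx_32 e_less_272 by (auto simp: abs_if split: if_splits)

lemma exp_9_le: "exp (9 :: real) \<le> 14735"
proof -
  have "exp (9 :: real) = exp 1 ^ 9"
    by (simp flip: exp_of_nat_mult)
  also have "\<dots> \<le> (272 / 100) ^ 9"
    by (intro power_mono exp_1_bounds) simp
  finally show ?thesis
    by (simp add: power_divide)
qed

lemma exp_9_ge: "7000 \<le> exp (9 :: real)"
proof -
  have "(27 / 10 :: real) ^ 9 \<le> exp 1 ^ 9"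
    by (intro power_mono exp_1_bounds) simp
  also have "\<dots> = exp (9 :: real)"
    by (simp flip: exp_of_nat_mult)
  finally show ?thesis
    by (simp add: power_divide)
qed

lemma exp_ge_2:
  fixes u :: real
  assumes "1 \<le> u"
  shows "2 \<le> exp u"
  using exp_ge_add_one_self[of u] assms by linarith

lemma Li_exp_9_le: "Li (exp 9) \<le> exp 9 / 9 + 3 / 2 * (exp 9 / 9\<^sup>2)"
proof -
  define e where "e = exp (1 :: real)"
  have pow: "exp (numeral n) = e ^ numeral n" for n
    by (simp add: e_def flip: exp_of_nat_mult)
  have e: "27 / 10 \<le> e" "e \<le> 272 / 100"
    using exp_1_bounds by (simp_all add: e_def)
  have lo: "e ^ 9 \<ge> (27 / 10) ^ 9" and up: "e ^ k \<le> (272 / 100) ^ k" for k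
    using e by (auto intro!: power_mono)
  \<comment> \<open>On this short initial range a constant bound from
    \<open>ln 2 \<ge> 2 / 3\<close> is good enough. The term \<open>Li 2\<close> vanishes, being an
    integral over a single point.\<close>
  have "Li (exp 2) - Li 2 \<le> 3 / 2 * exp 2 - 3 / 2 * 2"
  proof (rule Li_diff_le)
    fix t :: real assume "2 \<le> t"
    then have "2 / 3 \<le> ln t"
      using ln2_ge_two_thirds by (smt (verit) ln_le_cancel_iff)
    then show "1 / ln t \<le> 3 / 2"
      by (simp add: field_simps)
  qed (auto intro!: derivative_eq_intros exp_ge_2)
  then have "Li (e ^ 2) \<le> 3 / 2 * e ^ 2 - 3"
    by (simp add: pow Li_def)
  moreover have step: "Li (exp v) - Li (exp u) \<le> (exp v * (u + 1) - exp u * (v + 1)) / (u * v)"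
    if "2 \<le> u" "u \<le> v" for u v :: real
    using that by (intro Li_diff_exp_le exp_ge_2) auto
  note step[of 2 3] step[of 3 4] step[of 4 5] step[of 5 6] step[of 6 7] step[of 7 8] step[of 8 9]
  \<comment> \<open>The steps add up to \<open>e ^ 9 / 8\<close>, plus
    \<open>2 * e ^ k / ((k - 1) * k * (k + 1))\<close> for \<open>k\<close> from 3 to 8, plus
    \<open>5 / 6 * e ^ 2 - 3\<close>. The target is \<open>7 / 54 * e ^ 9\<close>, which leaves
    \<open>e ^ 9 / 216\<close> for the lower terms: about 35 are available and less than 32 are
    needed. Hence \<open>e ^ 9\<close> is bounded from below and the other powers from
    above.\<close>
  ultimately show ?thesis
    using lo up[of 2] up[of 3] up[of 4] up[of 5] up[of 6] up[of 7] up[of 8]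
    by (simp add: pow power_divide)
qed

lemma Li_le:
  assumes "exp 9 \<le> x"
  shows "Li x \<le> x / ln x + 3 / 2 * (x / (ln x)\<^sup>2)"
proof -
  have "Li x - Li (exp 9) \<le> (x / ln x + 3 / 2 * (x / (ln x)\<^sup>2)) -
    (exp 9 / ln (exp 9) + 3 / 2 * (exp 9 / (ln (exp 9))\<^sup>2))"
  proof (rule Li_diff_le)
    fix t :: real assume t: "exp 9 \<le> t"
    then have t1: "t > 1"
      using exp_9_ge by linarith
    then show "((\<lambda>t. t / ln t + 3 / 2 * (t / (ln t)\<^sup>2)) has_real_derivative
      1 / ln t + ((3 / 2 - 1) * ln t - 2 * (3 / 2)) / (ln t) ^ 3) (at t)"
      by (rule has_real_derivative_Li_approx)
    \<comment> \<open>This makes the numerator \<open>ln t / 2 - 3\<close> of the error term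
      positive.\<close>
    have "9 \<le> ln t"
      using t t1 by (simp add: ln_ge_iff)
    then show "1 / ln t \<le> 1 / ln t + ((3 / 2 - 1) * ln t - 2 * (3 / 2)) / (ln t) ^ 3"
      by simp
  qed (use assms in \<open>auto intro: exp_ge_2\<close>)
  then show ?thesis
    using Li_exp_9_le by simp
qed

text \<open>Up to \<open>exp 9\<close> the derivative of
  \<open>t / ln t + t / (ln t)\<^sup>2\<close> falls short of \<open>1 / ln t\<close> by at least
  \<open>2 / 9 ^ 3\<close>. So a linear term of that slope can be added to \<open>G\<close>, and its
  value at \<open>exp 9\<close>, more than 19, pays for the starting value \<open>G 2\<close>, which
  is less than 8.\<close>

lemma Li_exp_9_ge: "exp 9 / 9 + exp 9 / 9\<^sup>2 \<le> Li (exp 9)"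
proof -
  define G :: "real \<Rightarrow> real" where "G t = t / ln t + 1 * (t / (ln t)\<^sup>2) + 2 / 9 ^ 3 * t" for t
  have "G (exp 9) - G 2 \<le> Li (exp 9) - Li 2"
  proof (rule Li_diff_ge)
    fix t :: real assume t: "2 \<le> t" "t \<le> exp 9"
    show "(G has_real_derivative
      1 / ln t + ((1 - 1) * ln t - 2 * 1) / (ln t) ^ 3 + 2 / 9 ^ 3) (at t)"
      unfolding G_def
      by (intro DERIV_add has_real_derivative_Li_approx DERIV_cmult_Id) (use t in auto)
    have "0 < ln t" "ln t \<le> 9"
      using t ln_le_cancel_iff[of t "exp 9"] by auto
    then have "2 / 9 ^ 3 \<le> 2 / ln t ^ 3"
      by (intro divide_left_mono power_mono) auto
    then show "1 / ln t + ((1 - 1) * ln t - 2 * 1) / (ln t) ^ 3 + 2 / 9 ^ 3 \<le> 1 / ln t"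
      by simp
  qed (auto intro: exp_ge_2)
  moreover have "G 2 \<le> 2 / (2 / 3) + 1 * (2 / (2 / 3)\<^sup>2) + 2 / 9 ^ 3 * 2"
    unfolding G_def using ln2_ge_two_thirds
    by (intro add_mono divide_left_mono mult_left_mono power_mono) auto
  ultimately show ?thesis
    using exp_9_ge by (simp add: G_def Li_def power_divide)
qed

lemma Li_ge:
  assumes "exp 9 \<le> x"
  shows "x / ln x + x / (ln x)\<^sup>2 \<le> Li x"
proof -
  have "(x / ln x + 1 * (x / (ln x)\<^sup>2)) -
    (exp 9 / ln (exp 9) + 1 * (exp 9 / (ln (exp 9))\<^sup>2)) \<le> Li x - Li (exp 9)"
  proof (rule Li_diff_ge)
    fix t :: real assume t: "exp 9 \<le> t"
    then have t1: "t > 1"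
      using exp_9_ge by linarith
    then show "((\<lambda>t. t / ln t + 1 * (t / (ln t)\<^sup>2)) has_real_derivative
      1 / ln t + ((1 - 1) * ln t - 2 * 1) / (ln t) ^ 3) (at t)"
      by (rule has_real_derivative_Li_approx)
    show "1 / ln t + ((1 - 1) * ln t - 2 * 1) / (ln t) ^ 3 \<le> 1 / ln t"
      using t1 by simp
  qed (use assms in \<open>auto intro: exp_ge_2\<close>)
  then show ?thesis
    using Li_exp_9_ge by simp
qed

theorem theorem1p4:
  fixes q :: nat and a :: int and c_pi x_pi :: "nat \<Rightarrow> real" and x :: real
  assumes "q \<ge> 3"
    and "coprime a (int q)"
    and "pi_constants q (c_pi q) (x_pi q)"
    and "c_pi q * real (totient q) < 1"
    and "x > x_pi q"
  shows "x / (real (totient q) * ln x) < real (primes_ap_count x q a) \<and>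
         real (primes_ap_count x q a) < x / (real (totient q) * ln x) * (1 + 5 / (2 * ln x))"
proof -
  define \<phi> where "\<phi> = real (totient q)"
  define L where "L = ln x"
  define P where "P = real (primes_ap_count x q a)"
  have \<phi>: "\<phi> > 0"
    using assms(1) by (simp add: \<phi>_def)
  have x: "x > 14735" "exp 9 \<le> x"
    using assms(3,5) exp_9_le by (auto simp: pi_constants_def)
  have L: "L > 0"
    using x by (simp add: L_def)
  have "\<bar>P - Li x / \<phi>\<bar> < c_pi q * (x / L\<^sup>2)"
    using assms(2,3,5) unfolding P_def \<phi>_def L_def pi_constants_def pi_bound_from_def
    by (meson less_imp_le)
  \<comment> \<open>The hypothesis on \<open>c_pi q\<close> brings the error down to the size of the
    second-order terms in the bounds for \<open>Li x / \<phi>\<close>.\<close>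
  also have "c_pi q < 1 / \<phi>"
    using assms(4) \<phi> by (simp add: \<phi>_def field_simps)
  then have "c_pi q * (x / L\<^sup>2) \<le> 1 / \<phi> * (x / L\<^sup>2)"
    using x L by (intro mult_right_mono) auto
  finally have P: "\<bar>P - Li x / \<phi>\<bar> < x / L\<^sup>2 / \<phi>"
    by (simp add: mult.commute)
  have "x / L / \<phi> + x / L\<^sup>2 / \<phi> \<le> Li x / \<phi>"
    using divide_right_mono[OF Li_ge[OF x(2)], of \<phi>] \<phi> by (simp add: L_def add_divide_distrib)
  moreover have "Li x / \<phi> \<le> x / L / \<phi> + 3 / 2 * (x / L\<^sup>2 / \<phi>)"
    using divide_right_mono[OF Li_le[OF x(2)], of \<phi>] \<phi> by (simp add: L_def add_divide_distrib)
  \<comment> \<open>In units of \<open>x / L\<^sup>2 / \<phi>\<close> the error is less than 1: it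
    uses up the coefficient 1 of the lower bound and raises the 3/2 of the upper bound to 5/2.
    Strictness comes from the error bound.\<close>
  ultimately have "x / L / \<phi> < P" "P < x / L / \<phi> + 5 / 2 * (x / L\<^sup>2 / \<phi>)"
    using P by (auto simp: abs_less_iff)
  moreover have "x / L / \<phi> = x / (\<phi> * L)"
    "x / L / \<phi> + 5 / 2 * (x / L\<^sup>2 / \<phi>) = x / (\<phi> * L) * (1 + 5 / (2 * L))"
    using \<phi> L by (simp_all add: field_simps power2_eq_square)
  ultimately show ?thesis
    unfolding \<phi>_def L_def P_def by metis
qed

end
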